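(* Let $n\ge 1$ and let $d\ge 2$ be an even integer. For any real form $f\in\mathcal{F}_{d,n}$ with $\Vert f\Vert_B\le 1$, $$v\left(\frac{b_{d,n}}{\Vert b_{d,n}\Vert_B}\right)=\left(\prod_{i=0}^{d/2-1}\frac{2i+n}{2i+1}\right)^{n/(2d)}\frac{\sqrt{\pi}^{\,n}}{\Gamma\left(\frac n2+1\right)}\le v(f),$$ and equality holds if and only if $f=b_{d,n}/\Vert b_{d,n}\Vert_B$.
   Context: $\mathcal{F}_{d,n}$ is the real vector space of real homogeneous polynomials (forms) of degree $d$ in $n$ variables. For $f\in\mathcal{F}_{d,n}$, $v(f)=\mathrm{vol}\{x\in\mathbb{R}^n: f(x)\le 1\}\in[0,+\infty]$ is the Lebesgue volume of the sublevel set. $b_{d,n}(x)=(x_1^2+\dots+x_n^2)^{d/2}$. Writing $f(x)=\sum_{|\alpha|=d}f_\alpha\sqrt{\binom{d}{\alpha}}\,x^\alpha$ with $\binom{d}{\alpha}=\frac{d!}{\alpha_1!\cdots\alpha_n!}$, the Bombieri norm of $f$ is given by $\Vert f\Vert_B^2=\sum_{|\alpha|=d}f_\alpha^2$. *)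

theory Defs
  imports "HOL-Analysis.Analysis" "HOL-Library.Poly_Mapping"
begin

text \<open>
  A real polynomial in variables indexed by a finite type \<open>'n\<close> is a finitely supported map from
  exponent vectors to coefficients; addition and multiplication are those of
  \<^theory>\<open>HOL-Library.Poly_Mapping\<close> (multiplication is convolution over exponent vectors).
  The number of variables is \<open>CARD('n)\<close>.
\<close>

type_synonym 'n rpoly = "('n \<Rightarrow>\<^sub>0 nat) \<Rightarrow>\<^sub>0 real"

definition mdeg :: "('n::finite \<Rightarrow>\<^sub>0 nat) \<Rightarrow> nat" where
  "mdeg \<alpha> = (\<Sum>i\<in>UNIV. poly_mapping.lookup \<alpha> i)"

definition forms :: "nat \<Rightarrow> ('n::finite) rpoly set" where
  "forms d = {f. \<forall>\<alpha>\<in>Poly_Mapping.keys f. mdeg \<alpha> = d}"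

definition monom_eval :: "('n::finite \<Rightarrow>\<^sub>0 nat) \<Rightarrow> real ^ 'n \<Rightarrow> real" where
  "monom_eval \<alpha> x = (\<Prod>i\<in>UNIV. (x $ i) ^ poly_mapping.lookup \<alpha> i)"

definition eval_form :: "('n::finite) rpoly \<Rightarrow> real ^ 'n \<Rightarrow> real" where
  "eval_form f x = (\<Sum>\<alpha>\<in>Poly_Mapping.keys f. poly_mapping.lookup f \<alpha> * monom_eval \<alpha> x)"

definition scale_form :: "real \<Rightarrow> ('n::finite) rpoly \<Rightarrow> 'n rpoly" where
  "scale_form c f = Poly_Mapping.map ((*) c) f"

definition multinom :: "nat \<Rightarrow> ('n::finite \<Rightarrow>\<^sub>0 nat) \<Rightarrow> real" where
  "multinom d \<alpha> = fact d / (\<Prod>i\<in>UNIV. fact (poly_mapping.lookup \<alpha> i))"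

text \<open>
  The coefficient \<open>f\<^sub>\<alpha>\<close> in \<open>f(x) = (\<Sum>|\<alpha>| = d. f\<^sub>\<alpha> * sqrt (multinom d \<alpha>) * x\<^sup>\<alpha>)\<close>;
  see \<open>eval_form_bombieri_coeff\<close> below.
\<close>

definition bombieri_coeff :: "nat \<Rightarrow> ('n::finite) rpoly \<Rightarrow> ('n \<Rightarrow>\<^sub>0 nat) \<Rightarrow> real" where
  "bombieri_coeff d f \<alpha> = poly_mapping.lookup f \<alpha> / sqrt (multinom d \<alpha>)"

definition bombieri_norm :: "nat \<Rightarrow> ('n::finite) rpoly \<Rightarrow> real" where
  "bombieri_norm d f = sqrt (\<Sum>\<alpha> | mdeg \<alpha> = d. (bombieri_coeff d f \<alpha>)\<^sup>2)"

definition var :: "'n::finite \<Rightarrow> 'n rpoly" where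
  "var i = Poly_Mapping.single (Poly_Mapping.single i 1) 1"

text \<open>Only meaningful for even \<open>d\<close>.\<close>

definition b_form :: "nat \<Rightarrow> ('n::finite) rpoly" where
  "b_form d = (\<Sum>i\<in>UNIV. (var i)\<^sup>2) ^ (d div 2)"

definition b_unit :: "nat \<Rightarrow> ('n::finite) rpoly" where
  "b_unit d = scale_form (1 / bombieri_norm d (b_form d :: 'n rpoly)) (b_form d)"

definition sublevel_vol :: "('n::finite) rpoly \<Rightarrow> ennreal" where
  "sublevel_vol f = emeasure lebesgue {x. eval_form f x \<le> 1}"


lemma finite_mdeg: "finite {\<alpha> :: 'n::finite \<Rightarrow>\<^sub>0 nat. mdeg \<alpha> = d}"
proof (rule finite_imageD)
  have le: "poly_mapping.lookup \<alpha> i \<le> mdeg \<alpha>" for \<alpha> :: "'n \<Rightarrow>\<^sub>0 nat" and i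
    unfolding mdeg_def by (rule member_le_sum) auto
  have "poly_mapping.lookup ` {\<alpha> :: 'n \<Rightarrow>\<^sub>0 nat. mdeg \<alpha> = d} \<subseteq> (\<Pi>\<^sub>E i\<in>UNIV. {..d})"
    using le by (auto simp: PiE_UNIV_domain)
  moreover have "finite (\<Pi>\<^sub>E i\<in>(UNIV :: 'n set). {..d})"
    by (intro finite_PiE) simp_all
  ultimately show "finite (poly_mapping.lookup ` {\<alpha> :: 'n \<Rightarrow>\<^sub>0 nat. mdeg \<alpha> = d})"
    by (rule finite_subset)
  show "inj_on poly_mapping.lookup {\<alpha> :: 'n \<Rightarrow>\<^sub>0 nat. mdeg \<alpha> = d}"
    by (rule inj_onI) simp
qed

lemma eval_form_superset:
  assumes "finite A" "Poly_Mapping.keys f \<subseteq> A"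
  shows "eval_form f x = (\<Sum>\<alpha>\<in>A. poly_mapping.lookup f \<alpha> * monom_eval \<alpha> x)"
  unfolding eval_form_def using assms
  by (intro sum.mono_neutral_left) (auto simp: in_keys_iff)

lemma multinom_pos: "multinom d \<alpha> > 0"
  unfolding multinom_def by (intro divide_pos_pos prod_pos) auto

lemma eval_form_bombieri_coeff:
  assumes "f \<in> forms d"
  shows "eval_form f x =
    (\<Sum>\<alpha> | mdeg \<alpha> = d. bombieri_coeff d f \<alpha> * sqrt (multinom d \<alpha>) * monom_eval \<alpha> x)"
proof -
  have "sqrt (multinom d \<alpha>) \<noteq> 0" for \<alpha> :: "'a \<Rightarrow>\<^sub>0 nat"
    using multinom_pos[of d \<alpha>] by simp
  moreover have "eval_form f x = (\<Sum>\<alpha> | mdeg \<alpha> = d. poly_mapping.lookup f \<alpha> * monom_eval \<alpha> x)"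
    using assms by (intro eval_form_superset finite_mdeg) (auto simp: forms_def)
  ultimately show ?thesis
    by (simp add: bombieri_coeff_def)
qed

lemma monom_eval_add: "monom_eval (\<alpha> + \<beta>) x = monom_eval \<alpha> x * monom_eval \<beta> x"
  by (simp add: monom_eval_def lookup_add power_add prod.distrib)

lemma eval_form_single: "eval_form (Poly_Mapping.single \<alpha> c) x = c * monom_eval \<alpha> x"
  by (simp add: eval_form_def)

lemma eval_form_add: "eval_form (f + g) x = eval_form f x + eval_form g x"
proof -
  let ?A = "Poly_Mapping.keys f \<union> Poly_Mapping.keys g"
  have "eval_form h x = (\<Sum>\<alpha>\<in>?A. poly_mapping.lookup h \<alpha> * monom_eval \<alpha> x)" if "h \<in> {f, g, f + g}" for h
    using that keys_add[of f g] by (intro eval_form_superset) auto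
  then show ?thesis
    by (simp add: lookup_add algebra_simps sum.distrib)
qed

lemma eval_form_zero: "eval_form 0 x = 0"
  by (simp add: eval_form_def)

lemma eval_form_sum: "eval_form (\<Sum>i\<in>A. f i) x = (\<Sum>i\<in>A. eval_form (f i) x)"
  by (induction A rule: infinite_finite_induct) (auto simp: eval_form_zero eval_form_add)

lemma rpoly_expansion: "f = (\<Sum>\<alpha>\<in>Poly_Mapping.keys f. Poly_Mapping.single \<alpha> (poly_mapping.lookup f \<alpha>))"
  by (rule poly_mapping_eqI)
     (auto simp: lookup_sum lookup_single when_def in_keys_iff)

lemma eval_form_mult: "eval_form (f * g) x = eval_form f x * eval_form g x"
proof -
  have "f * g = (\<Sum>\<alpha>\<in>Poly_Mapping.keys f. Poly_Mapping.single \<alpha> (poly_mapping.lookup f \<alpha>)) *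
      (\<Sum>\<beta>\<in>Poly_Mapping.keys g. Poly_Mapping.single \<beta> (poly_mapping.lookup g \<beta>))"
    by (simp only: rpoly_expansion[symmetric])
  also have "\<dots> = (\<Sum>\<alpha>\<in>Poly_Mapping.keys f. \<Sum>\<beta>\<in>Poly_Mapping.keys g.
      Poly_Mapping.single (\<alpha> + \<beta>) (poly_mapping.lookup f \<alpha> * poly_mapping.lookup g \<beta>))"
    by (simp add: sum_product mult_single)
  finally have "eval_form (f * g) x = (\<Sum>\<alpha>\<in>Poly_Mapping.keys f. \<Sum>\<beta>\<in>Poly_Mapping.keys g.
      (poly_mapping.lookup f \<alpha> * monom_eval \<alpha> x) * (poly_mapping.lookup g \<beta> * monom_eval \<beta> x))"
    by (simp add: eval_form_sum eval_form_single monom_eval_add mult_ac)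
  then show ?thesis
    by (simp add: eval_form_def sum_product)
qed

lemma eval_form_one: "eval_form 1 x = 1"
  by (simp add: eval_form_def monom_eval_def)

lemma eval_form_power: "eval_form (f ^ k) x = eval_form f x ^ k"
  by (induction k) (auto simp: eval_form_one eval_form_mult)

lemma eval_form_var: "eval_form (var i) x = x $ i"
proof -
  have "monom_eval (Poly_Mapping.single i 1) x = (\<Prod>j\<in>UNIV. if j = i then x $ j else 1)"
    unfolding monom_eval_def by (intro prod.cong) (auto simp: lookup_single when_def)
  then show ?thesis
    by (simp add: var_def eval_form_single)
qed

lemma eval_b_form: "eval_form (b_form d) x = (\<Sum>i\<in>UNIV. (x $ i)\<^sup>2) ^ (d div 2)"
  by (simp add: b_form_def eval_form_power eval_form_sum eval_form_var)

lemma eval_scale_form: "eval_form (scale_form c f) x = c * eval_form f x"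
  unfolding scale_form_def mult_map_scale_conv_mult eval_form_mult eval_form_single
  by (simp add: monom_eval_def)

lemma forms_mult: "f \<in> forms d \<Longrightarrow> g \<in> forms e \<Longrightarrow> f * g \<in> forms (d + e)"
  using keys_mult[of f g] by (fastforce simp: forms_def mdeg_def lookup_add sum.distrib)

lemma forms_power: "f \<in> forms d \<Longrightarrow> f ^ k \<in> forms (k * d)"
proof (induction k)
  case 0
  then show ?case by (simp add: forms_def mdeg_def)
next
  case (Suc k)
  then have "f * f ^ k \<in> forms (d + k * d)"
    by (intro forms_mult)
  then show ?case by simp
qed

lemma forms_sum: "(\<And>i. i \<in> A \<Longrightarrow> f i \<in> forms d) \<Longrightarrow> (\<Sum>i\<in>A. f i) \<in> forms d"
  using keys_sum[of f A] by (fastforce simp: forms_def)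

lemma var_in_forms: "var i \<in> forms 1"
  by (simp add: var_def forms_def mdeg_def lookup_single when_def)

lemma b_form_in_forms:
  assumes "even d"
  shows "b_form d \<in> forms d"
proof -
  have "(\<Sum>i\<in>UNIV. (var i)\<^sup>2 :: 'a rpoly) \<in> forms 2"
    using forms_power[OF var_in_forms, of _ 2] by (intro forms_sum) simp
  from forms_power[OF this, of "d div 2"] show ?thesis
    using assms by (simp add: b_form_def)
qed

end

theory Submission
  imports Defs
begin

text \<open>
  Write \<open>g = b_unit d\<close> and let \<open>B\<close> be the set where \<open>g \<le> 1\<close>, a Euclidean ball. For a nonnegative form \<open>h\<close> of
  degree \<open>d\<close>, the layer-cake formula and homogeneity give \<open>\<integral> (1 - h)\<^sub>+ = K v(h)\<close>, where \<open>K\<close> is a positive finite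
  constant that does not depend on \<open>h\<close> (\<open>truncated_integral_eq_volume\<close>). A form with a negative value has infinite
  volume (\<open>negative_imp_infinite_volume\<close>), so only nonnegative \<open>f\<close> matter, and for these
  \[ K v(f) = \int (1 - f)_+ \ge \int_B (1 - f), \qquad K v(g) = \int (1 - g)_+ = \int_B (1 - g). \]
  It therefore suffices to compare the integrals of \<open>f\<close> and \<open>g\<close> over the ball \<open>B\<close>.

  On forms of degree \<open>d\<close>, integration over a ball centred at the origin is a positive multiple of the Bombieri
  inner product with \<open>b_form d\<close> (\<open>ball_integral_eq_bombieri_inner\<close>), because
  rotations leave both functionals invariant and an invariant functional is unique up to a factor. Up to this factor the two integrals over \<open>B\<close> are the inner products of \<open>f\<close> and of \<open>g\<close> with the unit
  vector \<open>g\<close>, and the Cauchy-Schwarz inequality yields \<open>v(g) \<le> v(f)\<close>. If the volumes agree, then equality holds in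
  Cauchy-Schwarz, which forces \<open>f = g\<close>.

  The explicit value of \<open>v(g)\<close> follows from the volume of a ball and from the Bombieri norm of \<open>b_form d\<close>, which is
  a coefficient of the power series \<open>(1 - 4t)\<^bsup>-n/2\<^esup>\<close> up to a factor (\<open>bombieri_norm_b_form_sq\<close>).
\<close>

section \<open>Monomials and homogeneous forms\<close>

lemma continuous_on_monom_eval [continuous_intros]: "continuous_on S (monom_eval \<alpha>)"
  unfolding monom_eval_def by (intro continuous_intros)

lemma continuous_on_eval_form [continuous_intros]: "continuous_on S (eval_form f)"
  unfolding eval_form_def by (intro continuous_intros)

lemma monom_eval_scaleR: "monom_eval \<alpha> (c *\<^sub>R x) = c ^ mdeg \<alpha> * monom_eval \<alpha> x"
  by (simp add: monom_eval_def mdeg_def power_mult_distrib prod.distrib power_sum)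

lemma eval_form_scaleR:
  assumes "f \<in> forms d"
  shows "eval_form f (c *\<^sub>R x) = c ^ d * eval_form f x"
  using assms unfolding eval_form_def sum_distrib_left
  by (intro sum.cong) (auto simp: monom_eval_scaleR forms_def)

lemma lookup_scale_form: "poly_mapping.lookup (scale_form c f) \<alpha> = c * poly_mapping.lookup f \<alpha>"
  unfolding scale_form_def by (simp add: map.rep_eq when_def)

lemma scale_form_in_forms: "f \<in> forms d \<Longrightarrow> scale_form c f \<in> forms d"
  by (auto simp: forms_def in_keys_iff lookup_scale_form)

lemma monom_eval_pointwise_mult:
  "monom_eval \<alpha> (\<chi> i. x $ i * y $ i) = monom_eval \<alpha> x * monom_eval \<alpha> y"
  by (simp add: monom_eval_def power_mult_distrib prod.distrib)

text \<open>
  The separating point has coordinate 2 in a variable whose exponents differ and 1 elsewhere.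
\<close>
lemma monom_eval_distinct:
  fixes \<alpha> \<beta> :: "'n::finite \<Rightarrow>\<^sub>0 nat"
  assumes "\<alpha> \<noteq> \<beta>"
  obtains y where "monom_eval \<alpha> y \<noteq> monom_eval \<beta> y"
proof -
  from assms obtain i where i: "poly_mapping.lookup \<alpha> i \<noteq> poly_mapping.lookup \<beta> i"
    by (meson poly_mapping_eqI)
  have ev: "monom_eval \<gamma> (\<chi> j. if j = i then 2 else 1) = 2 ^ poly_mapping.lookup \<gamma> i"
    for \<gamma> :: "'n \<Rightarrow>\<^sub>0 nat"
    unfolding monom_eval_def by (simp add: if_distrib[of "\<lambda>x. x ^ _"] prod.delta cong: if_cong)
  show ?thesis
    using i by (intro that[of "\<chi> j. if j = i then 2 else 1"]) (simp add: ev)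
qed

text \<open>
  Monomials are distinct characters of the monoid \<open>\<real>\<^sup>n\<close> under pointwise multiplication, so this is
  Dedekind's argument: given a relation, evaluating it at \<open>y x\<close> and subtracting
  \<open>\<alpha>0(y)\<close> times its value at \<open>x\<close> produces a relation from which the monomial \<open>\<alpha>0\<close> has disappeared.
\<close>
lemma monom_eval_independent:
  assumes "finite S" "\<And>x. (\<Sum>\<alpha>\<in>S. c \<alpha> * monom_eval \<alpha> x) = 0" "\<alpha> \<in> S"
  shows "c \<alpha> = 0"
  using assms
proof (induction S arbitrary: c \<alpha> rule: finite_induct)
  case empty
  then show ?case by simp
next
  case (insert \<alpha>0 S)
  have c0: "c \<beta> = 0" if "\<beta> \<in> S" for \<beta>
  proof -
    have "\<beta> \<noteq> \<alpha>0"
      using that insert.hyps by auto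
    then obtain y where y: "monom_eval \<beta> y \<noteq> monom_eval \<alpha>0 y"
      by (rule monom_eval_distinct)
    have "(\<Sum>\<gamma>\<in>S. (c \<gamma> * (monom_eval \<gamma> y - monom_eval \<alpha>0 y)) * monom_eval \<gamma> x) = 0" for x
    proof -
      have "(\<Sum>\<gamma>\<in>S. (c \<gamma> * (monom_eval \<gamma> y - monom_eval \<alpha>0 y)) * monom_eval \<gamma> x)
          = (\<Sum>\<gamma>\<in>insert \<alpha>0 S. (c \<gamma> * (monom_eval \<gamma> y - monom_eval \<alpha>0 y)) * monom_eval \<gamma> x)"
        using insert.hyps by simp
      also have "\<dots> = (\<Sum>\<gamma>\<in>insert \<alpha>0 S. c \<gamma> * monom_eval \<gamma> (\<chi> i. y $ i * x $ i))
          - monom_eval \<alpha>0 y * (\<Sum>\<gamma>\<in>insert \<alpha>0 S. c \<gamma> * monom_eval \<gamma> x)"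
        unfolding sum_distrib_left sum_subtractf[symmetric]
        by (intro sum.cong) (auto simp: monom_eval_pointwise_mult algebra_simps)
      also have "\<dots> = 0"
        using insert.prems(1) by simp
      finally show ?thesis .
    qed
    from insert.IH[OF this that] y show ?thesis by simp
  qed
  have "c \<alpha>0 * monom_eval \<alpha>0 (\<chi> i. 1) = 0"
    using insert.prems(1)[of "\<chi> i. 1"] insert.hyps c0 by simp
  then have "c \<alpha>0 = 0" by (simp add: monom_eval_def)
  with c0 insert.prems(2) show ?case by auto
qed

text \<open>
  This allows identities between coefficients to be read off from identities between polynomial functions.
\<close>
lemma eval_form_inject:
  assumes "\<And>x. eval_form f x = eval_form g x"
  shows "f = g"
proof (rule poly_mapping_eqI)
  fix \<alpha>
  let ?S = "insert \<alpha> (Poly_Mapping.keys f \<union> Poly_Mapping.keys g)"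
  have "poly_mapping.lookup f \<alpha> - poly_mapping.lookup g \<alpha> = 0"
  proof (rule monom_eval_independent[of ?S "\<lambda>\<alpha>. poly_mapping.lookup f \<alpha> - poly_mapping.lookup g \<alpha>"])
    fix x
    have "eval_form f x = (\<Sum>\<alpha>\<in>?S. poly_mapping.lookup f \<alpha> * monom_eval \<alpha> x)"
         "eval_form g x = (\<Sum>\<alpha>\<in>?S. poly_mapping.lookup g \<alpha> * monom_eval \<alpha> x)"
      by (intro eval_form_superset; auto)+
    with assms[of x] show "(\<Sum>\<alpha>\<in>?S. (poly_mapping.lookup f \<alpha> - poly_mapping.lookup g \<alpha>) * monom_eval \<alpha> x) = 0"
      by (simp only: left_diff_distrib sum_subtractf)
  qed auto
  then show "poly_mapping.lookup f \<alpha> = poly_mapping.lookup g \<alpha>" by simp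
qed

section \<open>The multinomial theorem and the coefficients of \<open>b_form\<close>\<close>

text \<open>
  Both multinomial sums below, that of the multinomial theorem and that of the norm of \<open>b_form d\<close>, are
  coefficients of a product of one power series per variable.
\<close>
lemma fps_prod_nth_mdeg:
  fixes F :: "'n::finite \<Rightarrow> real fps"
  shows "fps_nth (\<Prod>i\<in>UNIV. F i) k
    = (\<Sum>\<beta> | mdeg \<beta> = k. \<Prod>i\<in>UNIV. fps_nth (F i) (poly_mapping.lookup \<beta> i))"
proof -
  have [simp]: "poly_mapping.lookup (Abs_poly_mapping h) = h" for h :: "'n \<Rightarrow> nat"
    by (rule lookup_Abs_poly_mapping) simp
  have [simp]: "count (Abs_multiset h) = h" for h :: "'n \<Rightarrow> nat"
    by (rule Abs_multiset_inverse) simp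
  have size: "size X = (\<Sum>i\<in>UNIV. count X i)" for X :: "'n multiset"
    unfolding size_multiset_overloaded_eq by (intro sum.mono_neutral_left) (auto simp: not_in_iff)
  have "fps_nth (\<Prod>i\<in>UNIV. F i) k
    = (\<Sum>X\<in>multisets_of_size UNIV k. \<Prod>i\<in>UNIV. fps_nth (F i) (count X i))"
    by (rule fps_prod_nth') simp
  also have "\<dots> = (\<Sum>\<beta> | mdeg \<beta> = k. \<Prod>i\<in>UNIV. fps_nth (F i) (poly_mapping.lookup \<beta> i))"
    by (rule sum.reindex_bij_witness[of _ "\<lambda>\<beta>. Abs_multiset (poly_mapping.lookup \<beta>)"
             "\<lambda>X. Abs_poly_mapping (count X)"])
       (auto simp: multisets_of_size_def size mdeg_def count_inverse lookup_inverse)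
  finally show ?thesis .
qed

text \<open>
  Compare coefficients in \<open>exp (\<Sum>u\<^sub>i t) = \<Prod>exp (u\<^sub>i t)\<close>.
\<close>
lemma multinomial_theorem:
  fixes u :: "'n::finite \<Rightarrow> real"
  shows "(\<Sum>i\<in>UNIV. u i) ^ k
    = (\<Sum>\<beta> | mdeg \<beta> = k. multinom k \<beta> * (\<Prod>i\<in>UNIV. u i ^ poly_mapping.lookup \<beta> i))"
proof -
  have exp_sum: "fps_exp (\<Sum>i\<in>A. u i) = (\<Prod>i\<in>A. fps_exp (u i))" for A :: "'n set"
    by (induction A rule: infinite_finite_induct) (auto simp: fps_exp_add_mult)
  have "(\<Sum>i\<in>UNIV. u i) ^ k = fact k * fps_nth (\<Prod>i\<in>UNIV. fps_exp (u i)) k"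
    by (simp add: exp_sum[symmetric])
  also have "\<dots> = (\<Sum>\<beta> | mdeg \<beta> = k. multinom k \<beta> * (\<Prod>i\<in>UNIV. u i ^ poly_mapping.lookup \<beta> i))"
    unfolding fps_prod_nth_mdeg by (simp add: sum_distrib_left multinom_def prod_dividef)
  finally show ?thesis .
qed

lemma mdeg_double: "mdeg (\<beta> + \<beta>) = 2 * mdeg \<beta>"
  by (simp add: mdeg_def lookup_add sum.distrib mult_2)

lemma inj_double: "inj (\<lambda>\<beta> :: 'n \<Rightarrow>\<^sub>0 nat. \<beta> + \<beta>)"
proof (rule injI, rule poly_mapping_eqI)
  fix \<beta> \<gamma> :: "'n \<Rightarrow>\<^sub>0 nat" and i
  assume "\<beta> + \<beta> = \<gamma> + \<gamma>"
  then have "poly_mapping.lookup (\<beta> + \<beta>) i = poly_mapping.lookup (\<gamma> + \<gamma>) i" by simp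
  then show "poly_mapping.lookup \<beta> i = poly_mapping.lookup \<gamma> i" by (simp add: lookup_add)
qed

text \<open>
  The two sides agree as functions, by the multinomial theorem applied to the squares of the variables.
\<close>
lemma b_form_expansion:
  "b_form d = (\<Sum>\<beta> | mdeg \<beta> = d div 2. Poly_Mapping.single (\<beta> + \<beta>) (multinom (d div 2) \<beta>))"
  by (rule eval_form_inject)
     (simp add: eval_b_form eval_form_sum eval_form_single multinomial_theorem monom_eval_def
       lookup_add power_mult[symmetric] mult_2 mult_2_right)

lemma lookup_sum_single:
  assumes "finite S"
  shows "poly_mapping.lookup (\<Sum>\<alpha>\<in>S. Poly_Mapping.single \<alpha> (c \<alpha>)) \<beta> = (if \<beta> \<in> S then c \<beta> else 0)"
  using assms by (simp add: lookup_sum lookup_single when_def)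

lemma lookup_b_form_double:
  "poly_mapping.lookup (b_form d) (\<beta> + \<beta>) = (if mdeg \<beta> = d div 2 then multinom (d div 2) \<beta> else 0)"
  unfolding b_form_expansion
  by (simp add: lookup_sum lookup_single when_def inj_eq[OF inj_double] finite_mdeg)

lemma lookup_b_form_not_double:
  assumes "\<alpha> \<notin> range (\<lambda>\<beta>. \<beta> + \<beta>)"
  shows "poly_mapping.lookup (b_form d) \<alpha> = 0"
  unfolding b_form_expansion
  using assms by (auto simp: lookup_sum lookup_single when_def intro!: sum.neutral)

lemma eval_b_form_norm:
  assumes "even d"
  shows "eval_form (b_form d) x = norm x ^ d"
proof -
  have "eval_form (b_form d) x = ((norm x)\<^sup>2) ^ (d div 2)"
    unfolding eval_b_form norm_vec_def L2_set_def by (simp add: sum_nonneg)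
  then show ?thesis using assms by (simp flip: power_mult)
qed

section \<open>The Bombieri inner product\<close>

definition bombieri_inner :: "nat \<Rightarrow> ('n::finite) rpoly \<Rightarrow> 'n rpoly \<Rightarrow> real" where
  "bombieri_inner d f g = (\<Sum>\<alpha> | mdeg \<alpha> = d. bombieri_coeff d f \<alpha> * bombieri_coeff d g \<alpha>)"

lemma bombieri_norm_sq: "(bombieri_norm d f)\<^sup>2 = bombieri_inner d f f"
  by (simp add: bombieri_norm_def bombieri_inner_def power2_eq_square sum_nonneg)

lemma bombieri_norm_nonneg: "bombieri_norm d f \<ge> 0"
  by (simp add: bombieri_norm_def sum_nonneg)

lemma bombieri_inner_alt:
  "bombieri_inner d f g
    = (\<Sum>\<alpha> | mdeg \<alpha> = d. poly_mapping.lookup f \<alpha> * poly_mapping.lookup g \<alpha> / multinom d \<alpha>)"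
  unfolding bombieri_inner_def bombieri_coeff_def
  by (intro sum.cong) (auto simp: less_imp_le[OF multinom_pos])

lemma bombieri_inner_scale: "bombieri_inner d f (scale_form c g) = c * bombieri_inner d f g"
  by (simp add: bombieri_inner_alt lookup_scale_form sum_distrib_left mult_ac)

lemma bombieri_inner_commute: "bombieri_inner d f g = bombieri_inner d g f"
  by (simp add: bombieri_inner_def mult.commute)

lemma bombieri_dist_sq:
  "(\<Sum>\<alpha> | mdeg \<alpha> = d. (bombieri_coeff d f \<alpha> - bombieri_coeff d g \<alpha>)\<^sup>2)
    = (bombieri_norm d f)\<^sup>2 - 2 * bombieri_inner d f g + (bombieri_norm d g)\<^sup>2"
  unfolding bombieri_norm_sq bombieri_inner_def sum_distrib_left sum_subtractf[symmetric] sum.distrib[symmetric]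
  by (intro sum.cong) (auto simp: power2_eq_square algebra_simps)

text \<open>
  The squared Bombieri distance of \<open>f\<close> and \<open>g\<close> is nonnegative and at most \<open>1 - 2 * bombieri_inner d f g + 1\<close>.
\<close>
lemma bombieri_inner_le_1:
  assumes "bombieri_norm d f \<le> 1" "bombieri_norm d g \<le> 1"
  shows "bombieri_inner d f g \<le> 1"
proof -
  have "(bombieri_norm d f)\<^sup>2 \<le> 1" "(bombieri_norm d g)\<^sup>2 \<le> 1"
    using assms by (auto simp: power_le_one bombieri_norm_nonneg)
  moreover have "0 \<le> (\<Sum>\<alpha> | mdeg \<alpha> = d. (bombieri_coeff d f \<alpha> - bombieri_coeff d g \<alpha>)\<^sup>2)"
    by (intro sum_nonneg) auto
  ultimately show ?thesis unfolding bombieri_dist_sq by linarith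
qed

text \<open>
  The equality case of Cauchy-Schwarz: the squared Bombieri distance of \<open>f\<close> and \<open>g\<close> is at most \<open>1 - 2 + 1 = 0\<close>.
\<close>
lemma bombieri_inner_eq_1:
  assumes "bombieri_norm d f \<le> 1" "bombieri_norm d g \<le> 1" "bombieri_inner d f g \<ge> 1"
    and "f \<in> forms d" "g \<in> forms d"
  shows "f = g"
proof -
  have "(bombieri_norm d f)\<^sup>2 \<le> 1" "(bombieri_norm d g)\<^sup>2 \<le> 1"
    using assms by (auto simp: power_le_one bombieri_norm_nonneg)
  moreover have "0 \<le> (\<Sum>\<alpha> | mdeg \<alpha> = d. (bombieri_coeff d f \<alpha> - bombieri_coeff d g \<alpha>)\<^sup>2)"
    by (intro sum_nonneg) auto
  ultimately have "(\<Sum>\<alpha> | mdeg \<alpha> = d. (bombieri_coeff d f \<alpha> - bombieri_coeff d g \<alpha>)\<^sup>2) = 0"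
    using assms(3) unfolding bombieri_dist_sq by linarith
  then have eq: "bombieri_coeff d f \<alpha> = bombieri_coeff d g \<alpha>" if "mdeg \<alpha> = d" for \<alpha>
    using that by (subst (asm) sum_nonneg_eq_0_iff) (auto simp: finite_mdeg)
  show ?thesis
  proof (rule poly_mapping_eqI)
    fix \<alpha>
    show "poly_mapping.lookup f \<alpha> = poly_mapping.lookup g \<alpha>"
    proof (cases "mdeg \<alpha> = d")
      case True
      with eq[OF True] multinom_pos[of d \<alpha>] show ?thesis by (simp add: bombieri_coeff_def)
    next
      case False
      with assms(4,5) show ?thesis by (metis (mono_tags, lifting) forms_def in_keys_iff mem_Collect_eq)
    qed
  qed
qed

section \<open>The Bombieri norm of \<open>b_form\<close>\<close>

lemma gbinomial_neg_half:
  "(-4) ^ k * ((- x / 2 :: real) gchoose k) = 4 ^ k * pochhammer (x / 2) k / fact k"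
proof -
  have "(-4) ^ k * (-1) ^ k = (4 :: real) ^ k"
    by (simp flip: power_mult_distrib)
  then show ?thesis
    by (simp add: gbinomial_pochhammer flip: mult.assoc)
qed

lemma fact_double_four:
  "fact (2 * k) = 4 ^ k * pochhammer (1 / 2 :: real) k * fact k"
  using fact_double[of k, where 'a = real] by (simp add: power_mult)

text \<open>
  The central binomial coefficients are the coefficients of \<open>(1 - 4t)\<close> to the power \<open>-1/2\<close>.
\<close>
lemma fact_double_ratio:
  "fact (2 * j) / (fact j)\<^sup>2 = (-4) ^ j * ((-1/2 :: real) gchoose j)"
  using gbinomial_neg_half[of j 1] by (simp add: fact_double_four power2_eq_square)

lemma fact_double_product:
  "(fact k)\<^sup>2 / fact (2 * k) * ((-4) ^ k * ((- x / 2 :: real) gchoose k))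
    = (\<Prod>i<k. (2 * real i + x) / (2 * real i + 1))"
proof -
  have "(fact k)\<^sup>2 / fact (2 * k) * ((-4) ^ k * ((- x / 2 :: real) gchoose k))
    = pochhammer (x / 2) k / pochhammer (1/2) k"
    unfolding gbinomial_neg_half fact_double_four by (simp add: power2_eq_square)
  also have "\<dots> = (\<Prod>i<k. (2 * real i + x) / (2 * real i + 1))"
    unfolding pochhammer_prod prod_dividef[symmetric] atLeast0LessThan
    by (intro prod.cong) (auto simp: field_simps)
  finally show ?thesis .
qed

text \<open>
  By \<open>lookup_b_form_double\<close> the squared norm is, up to the factor \<open>(k!)\<^sup>2 / (2k)!\<close> with \<open>k = d / 2\<close>, the sum
  over all \<open>\<beta>\<close> of degree \<open>k\<close> of products of central binomial coefficients. That is the coefficient of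
  \<open>t\<^sup>k\<close> in the \<open>n\<close>-th power of \<open>(1 - 4t)\<^bsup>-1/2\<^esup>\<close>, that is, in \<open>(1 - 4t)\<^bsup>-n/2\<^esup>\<close>. The substitution of
  \<open>-4t\<close> for \<open>t\<close> appears below as the factor \<open>(-4)\<^sup>k\<close>.
\<close>
lemma bombieri_norm_b_form_sq:
  assumes "even d"
  shows "(bombieri_norm d (b_form d :: 'n::finite rpoly))\<^sup>2
    = (\<Prod>i<d div 2. (2 * real i + real CARD('n)) / (2 * real i + 1))"
proof -
  define k where "k = d div 2"
  have d: "d = 2 * k" using assms by (simp add: k_def)
  let ?b = "b_form d :: 'n rpoly"
  have "(bombieri_norm d ?b)\<^sup>2 = (\<Sum>\<alpha> | mdeg \<alpha> = d. (poly_mapping.lookup ?b \<alpha>)\<^sup>2 / multinom d \<alpha>)"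
    unfolding bombieri_norm_sq bombieri_inner_alt by (simp add: power2_eq_square)
  also have "\<dots> = (\<Sum>\<alpha>\<in>(\<lambda>\<beta>. \<beta> + \<beta>) ` {\<beta>. mdeg \<beta> = k}. (poly_mapping.lookup ?b \<alpha>)\<^sup>2 / multinom d \<alpha>)"
    by (rule sum.mono_neutral_right)
       (auto simp: finite_mdeg mdeg_double d intro!: lookup_b_form_not_double)
  also have "\<dots> = (\<Sum>\<beta> :: 'n \<Rightarrow>\<^sub>0 nat | mdeg \<beta> = k. (multinom k \<beta>)\<^sup>2 / multinom d (\<beta> + \<beta>))"
    by (subst sum.reindex[OF inj_on_subset[OF inj_double]])
       (auto simp: lookup_b_form_double d intro!: sum.cong)
  also have "\<dots> = (\<Sum>\<beta> :: 'n \<Rightarrow>\<^sub>0 nat | mdeg \<beta> = k. (fact k)\<^sup>2 / fact d *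
       ((-4) ^ k * (\<Prod>i\<in>UNIV. fps_nth (fps_binomial (-1/2)) (poly_mapping.lookup \<beta> i))))"
  proof (intro sum.cong refl)
    fix \<beta> :: "'n \<Rightarrow>\<^sub>0 nat" assume "\<beta> \<in> {\<beta>. mdeg \<beta> = k}"
    then have k: "k = (\<Sum>i\<in>UNIV. poly_mapping.lookup \<beta> i)" by (simp add: mdeg_def)
    have "(multinom k \<beta>)\<^sup>2 / multinom d (\<beta> + \<beta>) = (fact k)\<^sup>2 / fact d *
      (\<Prod>i\<in>UNIV. fact (2 * poly_mapping.lookup \<beta> i) / (fact (poly_mapping.lookup \<beta> i))\<^sup>2)"
      by (simp add: multinom_def lookup_add prod_dividef prod_power_distrib power_divide mult_2)
    also have "(\<Prod>i\<in>UNIV. fact (2 * poly_mapping.lookup \<beta> i) / (fact (poly_mapping.lookup \<beta> i))\<^sup>2 :: real)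
      = (-4) ^ k * (\<Prod>i\<in>UNIV. fps_nth (fps_binomial (-1/2)) (poly_mapping.lookup \<beta> i))"
      unfolding fact_double_ratio prod.distrib k power_sum by simp
    finally show "(multinom k \<beta>)\<^sup>2 / multinom d (\<beta> + \<beta>) = (fact k)\<^sup>2 / fact d *
       ((-4) ^ k * (\<Prod>i\<in>UNIV. fps_nth (fps_binomial (-1/2)) (poly_mapping.lookup \<beta> i)))" .
  qed
  also have "\<dots> = (fact k)\<^sup>2 / fact d *
       ((-4) ^ k * fps_nth (\<Prod>i\<in>(UNIV::'n set). fps_binomial (-1/2)) k)"
    unfolding fps_prod_nth_mdeg by (simp add: sum_distrib_left)
  also have "\<dots> = (fact k)\<^sup>2 / fact (2 * k) * ((-4) ^ k * ((- real CARD('n) / 2) gchoose k))"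
    by (simp add: fps_binomial_power d)
  also have "\<dots> = (\<Prod>i<k. (2 * real i + real CARD('n)) / (2 * real i + 1))"
    by (rule fact_double_product)
  finally show ?thesis by (simp add: k_def)
qed

lemma bombieri_norm_b_form_pos:
  assumes "even d"
  shows "bombieri_norm d (b_form d :: 'n::finite rpoly) > 0"
proof -
  have "(bombieri_norm d (b_form d :: 'n rpoly))\<^sup>2 > 0"
    unfolding bombieri_norm_b_form_sq[OF assms]
    by (intro prod_pos) (auto intro!: divide_pos_pos add_nonneg_pos)
  then show ?thesis
    using bombieri_norm_nonneg[of d "b_form d :: 'n rpoly"] by (auto simp: less_le)
qed

lemma b_unit_in_forms_norm_1:
  assumes "even d"
  shows "(b_unit d :: 'n::finite rpoly) \<in> forms d" "bombieri_norm d (b_unit d :: 'n rpoly) = 1"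
proof -
  let ?N = "bombieri_norm d (b_form d :: 'n rpoly)"
  show "(b_unit d :: 'n rpoly) \<in> forms d"
    unfolding b_unit_def by (intro scale_form_in_forms b_form_in_forms assms)
  have "bombieri_inner d (b_unit d :: 'n rpoly) (b_unit d) = (1 / ?N) * ((1 / ?N) * ?N\<^sup>2)"
    unfolding b_unit_def bombieri_inner_scale bombieri_inner_commute[of d "scale_form _ _"] bombieri_norm_sq ..
  also have "\<dots> = 1"
    using bombieri_norm_b_form_pos[OF assms, where 'n='n] by (simp add: power2_eq_square)
  finally have "(bombieri_norm d (b_unit d :: 'n rpoly))\<^sup>2 = 1"
    unfolding bombieri_norm_sq .
  then show "bombieri_norm d (b_unit d :: 'n rpoly) = 1"
    using bombieri_norm_nonneg[of d "b_unit d :: 'n rpoly"] by (simp add: power2_eq_1_iff)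
qed

section \<open>Rotation invariance of Lebesgue measure\<close>

lemma nn_integral_lborel_shift:
  fixes h :: "'a::euclidean_space \<Rightarrow> ennreal"
  assumes "h \<in> borel_measurable borel"
  shows "(\<integral>\<^sup>+x. h (x + y) \<partial>lborel) = (\<integral>\<^sup>+x. h x \<partial>lborel)"
proof -
  have "(\<integral>\<^sup>+x. h x \<partial>lborel) = (\<integral>\<^sup>+x. h x \<partial>distr lborel borel ((+) y))"
    by (simp add: lborel_distr_plus)
  also have "\<dots> = (\<integral>\<^sup>+x. h (x + y) \<partial>lborel)"
    using assms by (subst nn_integral_distr) (auto simp: add.commute)
  finally show ?thesis ..
qed

text \<open>
  The image measure \<open>\<mu>\<close> is translation invariant, like Lebesgue measure \<open>\<lambda>\<close>, and gives the unit ball \<open>B\<close> the same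
  measure. Uniqueness of Haar measure then gives the claim; its proof is a computation with Fubini's
  theorem. Integrating \<open>1\<^sub>A(x + y) 1\<^sub>B(y)\<close> over \<open>x\<close> first gives \<open>\<mu>(A) \<lambda>(B)\<close>; integrating over \<open>y\<close> first
  and shifting \<open>y\<close> by \<open>x\<close> gives \<open>\<lambda>(A) \<mu>(-B)\<close>, and \<open>\<mu>(-B) = \<mu>(B) = \<lambda>(B)\<close>.
\<close>
lemma lborel_distr_orthogonal:
  fixes T :: "'a::euclidean_space \<Rightarrow> 'a"
  assumes T: "orthogonal_transformation T"
  shows "distr lborel borel T = lborel"
proof -
  define \<mu> where "\<mu> = distr lborel borel T"
  have lin: "linear T" and nrm: "norm (T x) = norm x" for x
    using T by (auto simp: orthogonal_transformation)
  have [measurable]: "T \<in> borel_measurable borel"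
    using lin by (intro borel_measurable_continuous_onI linear_continuous_on linear_conv_bounded_linear[THEN iffD1])
  have sets_mu [measurable_cong, simp]: "sets \<mu> = sets borel" and space_mu [simp]: "space \<mu> = UNIV"
    by (simp_all add: \<mu>_def)
  have mu_ball: "emeasure \<mu> (ball 0 r) = emeasure lborel (ball 0 r :: 'a set)" for r
  proof -
    have "T -` ball 0 r = ball 0 r" using nrm by auto
    then show ?thesis by (simp add: \<mu>_def emeasure_distr)
  qed
  have lfin: "emeasure lborel (ball (0::'a) r) \<noteq> \<infinity>" for r
    by (metis emeasure_lborel_ball_finite less_irrefl infinity_ennreal_def)
  interpret \<mu>: sigma_finite_measure \<mu>
  proof
    show "\<exists>A. countable A \<and> A \<subseteq> sets \<mu> \<and> \<Union>A = space \<mu> \<and> (\<forall>a\<in>A. emeasure \<mu> a \<noteq> \<infinity>)"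
    proof (intro exI[of _ "range (\<lambda>k::nat. ball 0 (real k))"] conjI ballI)
      show "\<Union>(range (\<lambda>k::nat. ball (0::'a) (real k))) = space \<mu>"
        using reals_Archimedean2 by (fastforce simp: \<mu>_def)
    qed (use mu_ball lfin in auto)
  qed
  interpret pair_sigma_finite \<mu> "lborel :: 'a measure" ..
  have shift: "(\<integral>\<^sup>+x. h (x + y) \<partial>\<mu>) = (\<integral>\<^sup>+x. h x \<partial>\<mu>)"
    if [measurable]: "h \<in> borel_measurable borel" for h :: "'a \<Rightarrow> ennreal" and y
  proof -
    obtain z where z: "y = T z"
      using orthogonal_transformation_surj[OF T] by (metis surjD)
    have "(\<integral>\<^sup>+x. h (x + y) \<partial>\<mu>) = (\<integral>\<^sup>+x. h (T (x + z)) \<partial>lborel)"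
      unfolding \<mu>_def by (subst nn_integral_distr) (auto simp: z linear_add[OF lin])
    also have "\<dots> = (\<integral>\<^sup>+x. h (T x) \<partial>lborel)"
      by (rule nn_integral_lborel_shift[of "\<lambda>x. h (T x)"]) measurable
    also have "\<dots> = (\<integral>\<^sup>+x. h x \<partial>\<mu>)"
      unfolding \<mu>_def by (subst nn_integral_distr) auto
    finally show ?thesis .
  qed
  define B where "B = ball (0::'a) 1"
  have [measurable]: "B \<in> sets borel" by (simp add: B_def)
  have vol: "unit_ball_vol (real DIM('a)) \<noteq> 0"
    by (intro less_imp_neq[THEN not_sym] unit_ball_vol_pos) simp
  have lB: "emeasure lborel B \<noteq> 0" "emeasure lborel B \<noteq> \<infinity>"
    using lfin[of 1] vol by (auto simp: B_def emeasure_ball)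
  have "emeasure \<mu> A = emeasure lborel A" if A [measurable]: "A \<in> sets borel" for A
  proof -
    have "emeasure \<mu> A * emeasure lborel B
        = (\<integral>\<^sup>+y. (\<integral>\<^sup>+x. indicator A (x + y) * indicator B y \<partial>\<mu>) \<partial>lborel)"
      by (simp add: nn_integral_multc shift nn_integral_cmult)
    also have "\<dots> = (\<integral>\<^sup>+x. (\<integral>\<^sup>+y. indicator A (x + y) * indicator B y \<partial>lborel) \<partial>\<mu>)"
      by (rule Fubini') measurable
    also have "\<dots> = (\<integral>\<^sup>+x. (\<integral>\<^sup>+y. indicator A y * indicator B (y - x) \<partial>lborel) \<partial>\<mu>)"
    proof (rule nn_integral_cong)
      fix x
      show "(\<integral>\<^sup>+y. indicator A (x + y) * indicator B y \<partial>lborel)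
          = (\<integral>\<^sup>+y. indicator A y * indicator B (y - x) \<partial>lborel)"
        using nn_integral_lborel_shift[of "\<lambda>y. indicator A y * indicator B (y - x)" x]
        by (simp add: add.commute)
    qed
    also have "\<dots> = (\<integral>\<^sup>+y. (\<integral>\<^sup>+x. indicator A y * indicator B (y - x) \<partial>\<mu>) \<partial>lborel)"
      by (rule Fubini'[symmetric]) measurable
    also have "\<dots> = (\<integral>\<^sup>+y. indicator A y * emeasure \<mu> B \<partial>lborel)"
    proof (rule nn_integral_cong)
      fix y
      have "indicator B (y - x) = (indicator B (x + (- y)) :: ennreal)" for x
        by (simp add: B_def indicator_def norm_minus_commute)
      then show "(\<integral>\<^sup>+x. indicator A y * indicator B (y - x) \<partial>\<mu>) = indicator A y * emeasure \<mu> B"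
        using shift[of "indicator B" "- y"] by (simp add: nn_integral_cmult)
    qed
    also have "\<dots> = emeasure lborel A * emeasure lborel B"
      by (simp add: nn_integral_multc mu_ball B_def)
    finally show ?thesis
      using lB by (metis antisym ennreal_mult_le_mult_iff infinity_ennreal_def mult.commute order_refl)
  qed
  then show ?thesis
    by (intro measure_eqI) (auto simp: \<mu>_def)
qed

lemma ball_integral_orthogonal:
  fixes h :: "'a::euclidean_space \<Rightarrow> real" and T :: "'a \<Rightarrow> 'a"
  assumes T: "orthogonal_transformation T" and h: "h \<in> borel_measurable borel"
  shows "(LINT x:cball 0 R|lborel. h (T x)) = (LINT x:cball 0 R|lborel. h x)"
proof -
  have meas: "T \<in> measurable lborel borel"
    using orthogonal_transformation_linear[OF T]
    by (simp add: borel_measurable_continuous_onI linear_continuous_on linear_conv_bounded_linear)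
  have meas': "(\<lambda>x. indicator (cball 0 R) x *\<^sub>R h x) \<in> borel_measurable borel"
    using h by (intro borel_measurable_scaleR borel_measurable_indicator) auto
  have ind: "indicator (cball 0 R) (T x) = (indicator (cball 0 R) x :: real)" for x
    by (simp add: indicator_def orthogonal_transformation_norm[OF T])
  have "(LINT x:cball 0 R|lborel. h x) = (LINT x:cball 0 R|distr lborel borel T. h x)"
    by (simp only: lborel_distr_orthogonal[OF T])
  also have "\<dots> = (LINT x:cball 0 R|lborel. h (T x))"
    unfolding set_lebesgue_integral_def integral_distr[OF meas meas'] ind ..
  finally show ?thesis ..
qed

section \<open>Integrals of forms over balls\<close>

lemma ball_integrable:
  fixes h :: "'a::euclidean_space \<Rightarrow> real"
  assumes "continuous_on UNIV h"
  shows "set_integrable lborel (cball 0 R) h"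
  using assms unfolding set_integrable_def
  by (intro borel_integrable_compact) (auto intro: continuous_on_subset)

lemma ball_integral_sum:
  fixes h :: "'b \<Rightarrow> 'a::euclidean_space \<Rightarrow> real"
  assumes "\<And>i. i \<in> I \<Longrightarrow> continuous_on UNIV (h i)"
  shows "(LINT x:cball 0 R|lborel. (\<Sum>i\<in>I. c i * h i x)) = (\<Sum>i\<in>I. c i * (LINT x:cball 0 R|lborel. h i x))"
proof -
  have "integrable lborel (\<lambda>x. indicator (cball 0 R) x * h i x)" if "i \<in> I" for i
    using ball_integrable[OF assms[OF that], of R] by (simp add: set_integrable_def)
  then show ?thesis
    unfolding set_lebesgue_integral_def
    by (simp add: sum_distrib_left mult.left_commute)
qed

text \<open>
  A rotation carries the direction of \<open>e\<close> to that of \<open>a\<close> and preserves the ball.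
\<close>
lemma ball_integral_linear_power:
  fixes a e :: "real ^ 'n::finite"
  assumes "norm e = 1"
  shows "(LINT x:cball 0 R|lborel. (a \<bullet> x) ^ d) = norm a ^ d * (LINT x:cball 0 R|lborel. (e \<bullet> x) ^ d)"
proof -
  obtain T where T: "orthogonal_transformation T" and Ta: "T (norm a *\<^sub>R e) = a"
    using orthogonal_transformation_exists[of "norm a *\<^sub>R e" a] assms by auto
  have inner: "a \<bullet> T x = norm a * (e \<bullet> x)" for x
  proof -
    have "a \<bullet> T x = T (norm a *\<^sub>R e) \<bullet> T x"
      by (simp only: Ta)
    also have "\<dots> = norm a * (e \<bullet> x)"
      using T by (simp only: orthogonal_transformation_def inner_scaleR_left)
    finally show ?thesis .
  qed
  have "(LINT x:cball 0 R|lborel. (a \<bullet> x) ^ d) = (LINT x:cball 0 R|lborel. (a \<bullet> T x) ^ d)"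
    by (rule ball_integral_orthogonal[OF T, symmetric]) measurable
  also have "\<dots> = (LINT x:cball 0 R|lborel. norm a ^ d * (e \<bullet> x) ^ d)"
    by (simp add: inner power_mult_distrib)
  also have "\<dots> = norm a ^ d * (LINT x:cball 0 R|lborel. (e \<bullet> x) ^ d)"
    by simp
  finally show ?thesis .
qed

text \<open>
  Both sides are the coefficients at \<open>\<alpha>\<close> of the polynomial in \<open>a\<close> given by the integral of \<open>(a \<bullet> x)\<^sup>d\<close> over the ball:
  on the one hand the multinomial theorem expands the integrand, on the other hand the integral is a multiple
  of \<open>norm a ^ d\<close>, which is the value of \<open>b_form d\<close> at \<open>a\<close>.
\<close>
lemma monomial_ball_integral:
  fixes \<alpha> :: "'n::finite \<Rightarrow>\<^sub>0 nat"
  assumes "even d" "mdeg \<alpha> = d" "norm (e :: real ^ 'n) = 1"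
  shows "multinom d \<alpha> * (LINT x:cball 0 R|lborel. monom_eval \<alpha> x)
    = (LINT x:cball 0 R|lborel. (e \<bullet> x) ^ d) * poly_mapping.lookup (b_form d) \<alpha>"
proof -
  define C where "C = (LINT x:cball 0 R|lborel. (e \<bullet> x) ^ d)"
  define c where "c = (\<lambda>\<alpha> :: 'n \<Rightarrow>\<^sub>0 nat. multinom d \<alpha> * (LINT x:cball 0 R|lborel. monom_eval \<alpha> x))"
  define P where "P = (\<Sum>\<alpha> | mdeg \<alpha> = d. Poly_Mapping.single \<alpha> (c \<alpha>))"
  have "P = scale_form C (b_form d)"
  proof (rule eval_form_inject)
    fix a :: "real ^ 'n"
    have "(a \<bullet> x) ^ d = (\<Sum>\<alpha> | mdeg \<alpha> = d. (multinom d \<alpha> * monom_eval \<alpha> a) * monom_eval \<alpha> x)" for x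
      by (simp add: inner_vec_def multinomial_theorem monom_eval_def power_mult_distrib prod.distrib mult.assoc)
    then have "(LINT x:cball 0 R|lborel. (a \<bullet> x) ^ d)
      = (\<Sum>\<alpha> | mdeg \<alpha> = d. (multinom d \<alpha> * monom_eval \<alpha> a) * (LINT x:cball 0 R|lborel. monom_eval \<alpha> x))"
      by (simp add: ball_integral_sum continuous_on_monom_eval)
    also have "\<dots> = eval_form P a"
      by (simp add: P_def c_def eval_form_sum eval_form_single mult_ac)
    finally show "eval_form P a = eval_form (scale_form C (b_form d)) a"
      using ball_integral_linear_power[OF assms(3), of R a d] assms(1)
      by (simp add: eval_scale_form eval_b_form_norm C_def mult.commute)
  qed
  then have "poly_mapping.lookup P \<alpha> = C * poly_mapping.lookup (b_form d) \<alpha>"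
    by (simp add: lookup_scale_form)
  then show ?thesis
    using assms by (simp add: P_def lookup_sum_single finite_mdeg c_def C_def)
qed

text \<open>
  The link between the geometry and the Bombieri norm. Conceptually, \<open>(a \<bullet> x)\<^sup>d\<close> represents evaluation at \<open>a\<close>
  with respect to the Bombieri inner product, so integration over a ball is represented by the integral of
  these powers over \<open>a\<close>, a rotation-invariant form and hence a multiple of \<open>b_form d\<close>.
\<close>
lemma ball_integral_eq_bombieri_inner:
  fixes f :: "'n::finite rpoly"
  assumes "even d" "f \<in> forms d" "norm (e :: real ^ 'n) = 1"
  shows "(LINT x:cball 0 R|lborel. eval_form f x)
    = (LINT x:cball 0 R|lborel. (e \<bullet> x) ^ d) * bombieri_inner d f (b_form d)"
proof -
  have "eval_form f x = (\<Sum>\<alpha> | mdeg \<alpha> = d. poly_mapping.lookup f \<alpha> * monom_eval \<alpha> x)" for x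
    using assms(2) by (intro eval_form_superset finite_mdeg) (auto simp: forms_def)
  then have "(LINT x:cball 0 R|lborel. eval_form f x)
    = (\<Sum>\<alpha> | mdeg \<alpha> = d. poly_mapping.lookup f \<alpha> * (LINT x:cball 0 R|lborel. monom_eval \<alpha> x))"
    by (simp add: ball_integral_sum continuous_on_monom_eval)
  also have "\<dots> = (LINT x:cball 0 R|lborel. (e \<bullet> x) ^ d) * bombieri_inner d f (b_form d)"
    unfolding bombieri_inner_alt sum_distrib_left
  proof (intro sum.cong refl)
    fix \<alpha> :: "'n \<Rightarrow>\<^sub>0 nat" assume "\<alpha> \<in> {\<alpha>. mdeg \<alpha> = d}"
    then show "poly_mapping.lookup f \<alpha> * (LINT x:cball 0 R|lborel. monom_eval \<alpha> x)
      = (LINT x:cball 0 R|lborel. (e \<bullet> x) ^ d)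
        * (poly_mapping.lookup f \<alpha> * poly_mapping.lookup (b_form d) \<alpha> / multinom d \<alpha>)"
      using monomial_ball_integral[of d \<alpha> e R] assms multinom_pos[of d \<alpha>] by (simp add: field_simps)
  qed
  finally show ?thesis .
qed

text \<open>
  Needed to see that the constant in \<open>ball_integral_eq_bombieri_inner\<close> is positive, by taking \<open>f = b_form d\<close> there.
\<close>
lemma ball_integral_norm_power_pos:
  assumes "R > 0"
  shows "(LINT x:cball (0 :: 'a::euclidean_space) R|lborel. norm x ^ d) > 0"
proof -
  let ?h = "\<lambda>x::'a. indicator (cball 0 R) x * norm x ^ d :: real"
  have int: "integrable lborel ?h"
    using ball_integrable[of "\<lambda>x::'a. norm x ^ d" R]
    by (simp add: set_integrable_def continuous_intros)
  have "integral\<^sup>L lborel ?h \<noteq> 0"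
  proof
    assume "integral\<^sup>L lborel ?h = 0"
    then have "AE x in lborel. ?h x = 0"
      using integral_nonneg_eq_0_iff_AE[OF int] by simp
    moreover have "AE x in lborel. x \<noteq> (0::'a)"
      by (rule AE_lborel_singleton)
    ultimately have "AE x in lborel. x \<notin> cball (0::'a) R"
      by eventually_elim (auto simp: indicator_def)
    then have "emeasure lborel (cball (0::'a) R) = 0"
      by (subst (asm) AE_iff_measurable[of "cball 0 R"]) auto
    moreover have "unit_ball_vol (real DIM('a)) * R ^ DIM('a) > 0"
      using assms by simp
    ultimately show False
      using assms by (simp add: emeasure_cball ennreal_eq_0_iff)
  qed
  moreover have "integral\<^sup>L lborel ?h \<ge> 0"
    by (intro integral_nonneg_AE) auto
  ultimately show ?thesis
    unfolding set_lebesgue_integral_def real_scaleR_def by linarith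
qed

section \<open>Sublevel volumes and truncated integrals\<close>

lemma emeasure_lborel_dilation:
  fixes S :: "'a::euclidean_space set"
  assumes [measurable]: "S \<in> sets borel" and "c > 0"
  shows "emeasure lborel S = ennreal (c ^ DIM('a)) * emeasure lborel {x. c *\<^sub>R x \<in> S}"
proof -
  have "emeasure lborel S
    = emeasure (density (distr lborel borel (\<lambda>x. 0 + c *\<^sub>R x)) (\<lambda>_. \<bar>c\<bar> ^ DIM('a))) S"
    using assms by (subst lborel_affine[of c 0]) auto
  also have "\<dots> = ennreal (c ^ DIM('a)) * emeasure lborel {x. c *\<^sub>R x \<in> S}"
    using assms by (simp add: emeasure_density nn_integral_cmult emeasure_distr vimage_def)
  finally show ?thesis .
qed

text \<open>
  The open cone where \<open>F\<close> is negative is invariant under dilation by 2, which multiplies volumes by a power of 2;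
  its volume is not zero, so it is infinite.
\<close>
lemma negative_imp_infinite_volume:
  fixes F :: "'a::euclidean_space \<Rightarrow> real"
  assumes cont: "continuous_on UNIV F"
    and hom: "\<And>c x. F (c *\<^sub>R x) = c ^ d * F x"
    and neg: "F z < 0"
  shows "emeasure lborel {x. F x \<le> 1} = \<infinity>"
proof -
  let ?U = "{x. F x < 0}"
  have op: "open ?U"
    using cont by (intro open_Collect_less) auto
  then have pos: "emeasure lborel ?U \<noteq> 0"
    using neg open_not_negligible[OF op] by (auto simp: negligible_iff_emeasure0)
  have "emeasure lborel ?U = ennreal (2 ^ DIM('a)) * emeasure lborel ?U"
    using emeasure_lborel_dilation[of ?U 2] op by (simp add: hom mult_less_0_iff borel_open)
  have inf: "emeasure lborel ?U = \<infinity>"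
  proof (rule ccontr)
    assume fin: "emeasure lborel ?U \<noteq> \<infinity>"
    define m where "m = measure lborel ?U"
    have m: "emeasure lborel ?U = ennreal m" "m \<ge> 0"
      using fin by (auto simp: m_def emeasure_eq_ennreal_measure)
    have "ennreal m = ennreal (2 ^ DIM('a) * m)"
      using \<open>emeasure lborel ?U = _ * _\<close> m by (simp add: ennreal_mult)
    with m have "m = 2 ^ DIM('a) * m" by simp
    moreover have "(2::real) ^ DIM('a) > 1" by simp
    ultimately have "m = 0" by auto
    with m pos show False by simp
  qed
  have "closed {x. F x \<le> 1}"
    using cont by (intro closed_Collect_le) auto
  then have "emeasure lborel ?U \<le> emeasure lborel {x. F x \<le> 1}"
    by (intro emeasure_mono) auto
  with inf show ?thesis by (simp add: top_unique)
qed

text \<open>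
  Layer-cake formula: \<open>ennreal (1 - F x)\<close> is the positive part of \<open>1 - F x\<close>, hence the length of the set of
  \<open>t \<le> 1\<close> with \<open>F x \<le> t\<close>. After exchanging the integrals, homogeneity turns the volume of the sublevel set
  at \<open>t\<close> into a multiple of that at 1. The first factor on the right, equal to \<open>1 / (n/d + 1)\<close>, is left as an integral: as it depends on \<open>d\<close> and
  the dimension only, it cancels when volumes are compared.
\<close>
lemma truncated_integral_eq_volume:
  fixes F :: "'a::euclidean_space \<Rightarrow> real"
  assumes cont: "continuous_on UNIV F" and d: "d > 0"
    and hom: "\<And>c x. F (c *\<^sub>R x) = c ^ d * F x"
    and nonneg: "\<And>x. F x \<ge> 0"
  shows "(\<integral>\<^sup>+x. ennreal (1 - F x) \<partial>lborel)
    = (\<integral>\<^sup>+t. ennreal (root d t ^ DIM('a)) * indicator {0<..1} t \<partial>lborel) * emeasure lborel {x. F x \<le> 1}"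
proof -
  have [measurable]: "F \<in> borel_measurable borel"
    using cont by (rule borel_measurable_continuous_onI)
  have "(\<integral>\<^sup>+x. ennreal (1 - F x) \<partial>lborel) = (\<integral>\<^sup>+x. (\<integral>\<^sup>+t. indicator {t. F x \<le> t \<and> t \<le> 1} t \<partial>lborel) \<partial>lborel)"
  proof (rule nn_integral_cong)
    fix x
    have eq: "{t. F x \<le> t \<and> t \<le> 1} = {F x..1}" by auto
    show "ennreal (1 - F x) = (\<integral>\<^sup>+t. indicator {t. F x \<le> t \<and> t \<le> 1} t \<partial>lborel)"
      unfolding eq by (cases "F x \<le> 1") (auto simp: ennreal_neg)
  qed
  also have "\<dots> = (\<integral>\<^sup>+t. (\<integral>\<^sup>+x. indicator {t. F x \<le> t \<and> t \<le> 1} t \<partial>lborel) \<partial>lborel)"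
    by (rule lborel_pair.Fubini'[symmetric]) measurable
  also have "\<dots> = (\<integral>\<^sup>+t. ennreal (root d t ^ DIM('a)) * indicator {0<..1} t * emeasure lborel {x. F x \<le> 1} \<partial>lborel)"
  proof (rule nn_integral_cong_AE)
    have "AE t in lborel. t \<noteq> (0::real)"
      by (rule AE_lborel_singleton)
    then show "AE t in lborel. (\<integral>\<^sup>+x. indicator {t. F x \<le> t \<and> t \<le> 1} t \<partial>lborel)
      = ennreal (root d t ^ DIM('a)) * indicator {0<..1} t * emeasure lborel {x. F x \<le> 1}"
    proof (rule AE_mp, intro AE_I2 impI)
      fix t :: real assume "t \<noteq> 0"
      then consider "t < 0" | "0 < t" "t \<le> 1" | "t > 1" by linarith
      then show "(\<integral>\<^sup>+x. indicator {t. F x \<le> t \<and> t \<le> 1} t \<partial>lborel)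
        = ennreal (root d t ^ DIM('a)) * indicator {0<..1} t * emeasure lborel {x. F x \<le> 1}"
      proof cases
        case 1
        then have "\<not> F x \<le> t" for x using nonneg[of x] by linarith
        with 1 show ?thesis by simp
      next
        case 2
        let ?c = "root d t"
        have c: "?c > 0" "?c ^ d = t" using 2 d by auto
        have "(\<integral>\<^sup>+x. indicator {t. F x \<le> t \<and> t \<le> 1} t \<partial>lborel) = (\<integral>\<^sup>+x. indicator {x. F x \<le> t} x \<partial>(lborel::'a measure))"
          using 2 by (intro nn_integral_cong) (auto simp: indicator_def)
        also have "\<dots> = emeasure lborel {x. F x \<le> t}" by simp
        also have "\<dots> = ennreal (?c ^ DIM('a)) * emeasure lborel {x. ?c *\<^sub>R x \<in> {x. F x \<le> t}}"
          using c by (intro emeasure_lborel_dilation) auto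
        also have "{x. ?c *\<^sub>R x \<in> {x. F x \<le> t}} = {x. F x \<le> 1}"
          using 2 by (simp add: hom c)
        finally show ?thesis using 2 by simp
      qed simp
    qed
  qed
  also have "\<dots> = (\<integral>\<^sup>+t. ennreal (root d t ^ DIM('a)) * indicator {0<..1} t \<partial>lborel) * emeasure lborel {x. F x \<le> 1}"
    by (rule nn_integral_multc) measurable
  finally show ?thesis .
qed

lemma dilation_constant_pos_finite:
  fixes d n :: nat
  assumes "d > 0"
  defines "K \<equiv> (\<integral>\<^sup>+t. ennreal (root d t ^ n) * indicator {0<..1} t \<partial>lborel)"
  shows "K \<noteq> 0" "K \<noteq> \<infinity>"
proof -
  show "K \<noteq> 0"
  proof
    assume "K = 0"
    then have "AE t in lborel. ennreal (root d t ^ n) * indicator {0<..1} t = 0"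
      unfolding K_def by (subst (asm) nn_integral_0_iff_AE) auto
    then have "AE t in lborel. t \<notin> {0<..1::real}"
      by eventually_elim (use assms in \<open>auto simp: indicator_def split: if_splits\<close>)
    then have "emeasure lborel {0<..1::real} = 0"
      by (subst (asm) AE_iff_measurable[of "{0<..1}"]) auto
    then show False by simp
  qed
  have "K \<le> (\<integral>\<^sup>+t. indicator {0<..1::real} t \<partial>lborel)"
    unfolding K_def using assms
    by (intro nn_integral_mono) (auto simp: indicator_def power_le_one)
  also have "\<dots> = 1" by simp
  finally show "K \<noteq> \<infinity>" by (auto simp: top_unique)
qed

text \<open>
  The positive part of \<open>h\<close> is bounded below by \<open>h\<close> on any ball and by 0 elsewhere.
\<close>
lemma truncated_integral_ge_ball_integral:
  fixes h :: "'a::euclidean_space \<Rightarrow> real"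
  assumes "continuous_on UNIV h"
  shows "ennreal (LINT x:cball 0 R|lborel. h x) \<le> (\<integral>\<^sup>+x. ennreal (h x) \<partial>lborel)"
proof -
  have h [measurable]: "h \<in> borel_measurable borel"
    using assms by (rule borel_measurable_continuous_onI)
  have cont: "continuous_on UNIV (\<lambda>x. max 0 (h x))"
    using assms by (intro continuous_intros)
  have "ennreal (LINT x:cball 0 R|lborel. h x) \<le> ennreal (LINT x:cball 0 R|lborel. max 0 (h x))"
    by (intro ennreal_leI set_integral_mono ball_integrable assms cont) auto
  also have "\<dots> = (\<integral>\<^sup>+x. ennreal (indicator (cball 0 R) x * max 0 (h x)) \<partial>lborel)"
    using ball_integrable[OF cont, of R]
    by (subst nn_integral_eq_integral) (auto simp: set_lebesgue_integral_def set_integrable_def)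
  also have "\<dots> \<le> (\<integral>\<^sup>+x. ennreal (h x) \<partial>lborel)"
    by (intro nn_integral_mono) (auto simp: indicator_def max_def)
  finally show ?thesis .
qed

lemma sublevel_vol_lborel: "sublevel_vol f = emeasure lborel {x. eval_form f x \<le> 1}"
proof -
  have "closed {x. eval_form f x \<le> 1}"
    by (intro closed_Collect_le continuous_intros)
  then show ?thesis by (simp add: sublevel_vol_def borel_closed)
qed

section \<open>The extremal form\<close>

lemma b_unit_sublevel:
  assumes "even d" "d > 0"
  shows "{x. eval_form (b_unit d :: 'n::finite rpoly) x \<le> 1}
    = cball 0 (root d (bombieri_norm d (b_form d :: 'n rpoly)))"
proof -
  let ?N = "bombieri_norm d (b_form d :: 'n rpoly)"
  have "eval_form (b_unit d :: 'n rpoly) x \<le> 1 \<longleftrightarrow> norm x ^ d \<le> ?N" for x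
    using bombieri_norm_b_form_pos[OF assms(1), where 'n='n] assms(1)
    by (simp add: b_unit_def eval_scale_form eval_b_form_norm)
  moreover have "norm x ^ d \<le> ?N \<longleftrightarrow> norm x \<le> root d ?N" for x :: "real ^ 'n"
    using real_root_le_iff[OF assms(2), of "norm x ^ d" ?N] by (simp add: real_root_power_cancel assms(2))
  ultimately show ?thesis by (auto simp: dist_norm)
qed

text \<open>
  The sublevel set is a ball whose radius is the \<open>d\<close>-th root of the Bombieri norm \<open>N\<close> of \<open>b_form d\<close>; the product in the statement is
  \<open>N\<^sup>2\<close>, whence the 2 in the denominator of the exponent.
\<close>
lemma sublevel_vol_b_unit:
  assumes "even d" "d \<ge> 2"
  shows "sublevel_vol (b_unit d :: 'n::finite rpoly)
      = ennreal ((\<Prod>i = 0..d div 2 - 1. (2 * real i + real CARD('n)) / (2 * real i + 1))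
            powr (real CARD('n) / (2 * real d))
          * (sqrt pi ^ CARD('n) / Gamma (real CARD('n) / 2 + 1)))"
proof -
  let ?N = "bombieri_norm d (b_form d :: 'n rpoly)"
  have N: "?N > 0" by (rule bombieri_norm_b_form_pos[OF assms(1)])
  have "{..<d div 2} = {0..d div 2 - 1}"
    using assms by auto
  then have prod: "(\<Prod>i = 0..d div 2 - 1. (2 * real i + real CARD('n)) / (2 * real i + 1)) = ?N\<^sup>2"
    by (simp add: bombieri_norm_b_form_sq[OF assms(1)])
  have "sublevel_vol (b_unit d :: 'n rpoly) = ennreal (unit_ball_vol CARD('n) * root d ?N ^ CARD('n))"
    using N assms by (simp add: sublevel_vol_lborel b_unit_sublevel emeasure_cball)
  also have "root d ?N ^ CARD('n) = ?N powr (CARD('n) / d)"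
    using N assms by (simp add: root_powr_inverse powr_powr flip: powr_realpow)
  also have "\<dots> = (?N\<^sup>2) powr (CARD('n) / (2 * d))"
    using N by (simp add: powr_powr flip: powr_numeral)
  also have "unit_ball_vol CARD('n) = sqrt pi ^ CARD('n) / Gamma (CARD('n) / 2 + 1)"
    unfolding unit_ball_vol_def
    by (simp add: powr_half_sqrt[symmetric] powr_powr flip: powr_realpow)
  finally show ?thesis unfolding prod by (simp add: mult.commute)
qed

text \<open>
  The truncation acts exactly outside the ball on which \<open>b_unit d\<close> is at most 1.
\<close>
lemma truncated_integral_b_unit:
  assumes "even d" "d > 0"
  defines "B \<equiv> cball 0 (root d (bombieri_norm d (b_form d :: 'n::finite rpoly)))"
  shows "(\<integral>\<^sup>+x. ennreal (1 - eval_form (b_unit d :: 'n rpoly) x) \<partial>lborel)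
      = ennreal (LINT x:B|lborel. 1 - eval_form (b_unit d :: 'n rpoly) x)"
    and "0 \<le> (LINT x:B|lborel. 1 - eval_form (b_unit d :: 'n rpoly) x)"
proof -
  let ?g = "b_unit d :: 'n rpoly"
  have B: "x \<in> B \<longleftrightarrow> eval_form ?g x \<le> 1" for x
    unfolding B_def b_unit_sublevel[OF assms(1,2), symmetric] by simp
  have int: "integrable lborel (\<lambda>x. indicator B x * (1 - eval_form ?g x))"
    using ball_integrable[of "\<lambda>x. 1 - eval_form ?g x"]
    unfolding B_def set_integrable_def by (simp add: continuous_intros)
  have nn: "0 \<le> indicator B x * (1 - eval_form ?g x)" for x
    using B[of x] by (auto simp: indicator_def)
  have "(\<integral>\<^sup>+x. ennreal (1 - eval_form ?g x) \<partial>lborel)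
    = (\<integral>\<^sup>+x. ennreal (indicator B x * (1 - eval_form ?g x)) \<partial>lborel)"
    using B by (intro nn_integral_cong) (auto simp: indicator_def ennreal_neg)
  also have "\<dots> = ennreal (LINT x:B|lborel. 1 - eval_form ?g x)"
    using int nn by (subst nn_integral_eq_integral) (auto simp: set_lebesgue_integral_def)
  finally show "(\<integral>\<^sup>+x. ennreal (1 - eval_form ?g x) \<partial>lborel) = ennreal (LINT x:B|lborel. 1 - eval_form ?g x)" .
  show "0 \<le> (LINT x:B|lborel. 1 - eval_form ?g x)"
    using nn unfolding set_lebesgue_integral_def by (intro integral_nonneg_AE) auto
qed

section \<open>The minimal volume\<close>

theorem mainTheorem4:
  fixes d :: nat and f :: "('n::finite) rpoly"
  assumes "d \<ge> 2" and "even d"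
    and "f \<in> forms d"
    and "bombieri_norm d f \<le> 1"
  shows "sublevel_vol (b_unit d :: 'n rpoly)
      = ennreal ((\<Prod>i = 0..d div 2 - 1. (2 * real i + real CARD('n)) / (2 * real i + 1))
            powr (real CARD('n) / (2 * real d))
          * (sqrt pi ^ CARD('n) / Gamma (real CARD('n) / 2 + 1)))
    \<and> sublevel_vol (b_unit d :: 'n rpoly) \<le> sublevel_vol f
    \<and> (sublevel_vol (b_unit d :: 'n rpoly) = sublevel_vol f \<longleftrightarrow> f = b_unit d)"
proof -
  let ?g = "b_unit d :: 'n rpoly" and ?b = "b_form d :: 'n rpoly"
  define N where "N = bombieri_norm d ?b"
  define B where "B = cball (0 :: real ^ 'n) (root d N)"
  have d: "d > 0" using assms by simp
  have N: "N > 0" unfolding N_def by (rule bombieri_norm_b_form_pos[OF assms(2)])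
  note g = b_unit_in_forms_norm_1[OF assms(2), where 'n='n]
  have vol_g: "sublevel_vol ?g \<noteq> \<infinity>"
    by (simp add: sublevel_vol_b_unit[OF assms(2,1)])
  obtain e :: "real ^ 'n" where e: "norm e = 1"
    using norm_axis_1 by blast
  \<comment> \<open>Integration over \<open>B\<close> is \<open>C\<close> times the inner product with \<open>b_form d\<close>, which is \<open>N\<close> times the unit vector \<open>?g\<close>.\<close>
  define C where "C = (LINT x:B|lborel. (e \<bullet> x) ^ d)"
  have int: "(LINT x:B|lborel. eval_form h x) = (C * N) * bombieri_inner d h ?g"
    if "h \<in> forms d" for h :: "'n rpoly"
    using ball_integral_eq_bombieri_inner[OF assms(2) that e] N
    by (simp add: B_def C_def b_unit_def bombieri_inner_scale N_def)
  have inner_g: "bombieri_inner d ?g ?g = 1"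
    using g(2) by (simp flip: bombieri_norm_sq)
  \<comment> \<open>Testing the formula on \<open>b_form d\<close>, whose integral is positive, shows that the constant is positive.\<close>
  have "0 < (LINT x:B|lborel. eval_form ?b x)"
    using ball_integral_norm_power_pos[of "root d N" d] N d
    by (simp add: eval_b_form_norm[OF assms(2)] B_def)
  also have "\<dots> = C * N\<^sup>2"
    using ball_integral_eq_bombieri_inner[OF assms(2) b_form_in_forms[OF assms(2)] e, of "root d N"]
    by (simp add: B_def C_def N_def bombieri_norm_sq)
  finally have CN: "C * N > 0"
    using N by (simp add: zero_less_mult_iff)
  have sub: "(LINT x:B|lborel. 1 - eval_form h x) = measure lborel B - (LINT x:B|lborel. eval_form h x)"
    for h :: "'n rpoly"
  proof -
    have "(LINT x:B|lborel. 1 - eval_form h x) = (LINT x:B|lborel. 1) - (LINT x:B|lborel. eval_form h x)"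
      unfolding B_def by (intro set_integral_diff ball_integrable continuous_intros)
    then show ?thesis
      by (simp add: set_lebesgue_integral_def B_def)
  qed
  let ?K = "\<integral>\<^sup>+t. ennreal (root d t ^ CARD('n)) * indicator {0<..1} t \<partial>lborel"
  have K: "?K \<noteq> 0" "?K \<noteq> \<infinity>" using dilation_constant_pos_finite[OF d] by auto
  have layer: "(\<integral>\<^sup>+x. ennreal (1 - eval_form h x) \<partial>lborel) = ?K * sublevel_vol h"
    if "h \<in> forms d" "\<And>x. eval_form h x \<ge> 0" for h :: "'n rpoly"
    using truncated_integral_eq_volume[of "eval_form h" d] that d
    by (simp add: sublevel_vol_lborel eval_form_scaleR continuous_on_eval_form)
  have g_nonneg: "eval_form ?g x \<ge> 0" for x
    using N by (simp add: b_unit_def eval_scale_form eval_b_form_norm[OF assms(2)] N_def)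
  have vol_neg: "sublevel_vol f = \<infinity>" if "eval_form f z < 0" for z
    unfolding sublevel_vol_lborel
    using that by (intro negative_imp_infinite_volume[of _ d]) (auto intro: continuous_intros eval_form_scaleR assms)
  have lower: "ennreal (LINT x:B|lborel. 1 - eval_form f x) \<le> ?K * sublevel_vol f"
    if "\<And>x. eval_form f x \<ge> 0"
    unfolding layer[OF assms(3) that, symmetric] B_def
    by (intro truncated_integral_ge_ball_integral continuous_intros)
  have vol_g_eq: "?K * sublevel_vol ?g = ennreal (LINT x:B|lborel. 1 - eval_form ?g x)"
    unfolding layer[OF g(1) g_nonneg, symmetric] B_def N_def
    by (rule truncated_integral_b_unit[OF assms(2) d])
  have nonneg_g: "0 \<le> (LINT x:B|lborel. 1 - eval_form ?g x)"
    unfolding B_def N_def by (rule truncated_integral_b_unit[OF assms(2) d])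
  have le: "sublevel_vol ?g \<le> sublevel_vol f"
  proof (cases "\<forall>x. eval_form f x \<ge> 0")
    case True
    have "(LINT x:B|lborel. 1 - eval_form ?g x) \<le> (LINT x:B|lborel. 1 - eval_form f x)"
      unfolding sub int[OF g(1)] int[OF assms(3)] inner_g
      using mult_left_mono[OF bombieri_inner_le_1[OF assms(4), of ?g] less_imp_le[OF CN]] g(2) by simp
    then have "?K * sublevel_vol ?g \<le> ennreal (LINT x:B|lborel. 1 - eval_form f x)"
      unfolding vol_g_eq by (rule ennreal_leI)
    also have "\<dots> \<le> ?K * sublevel_vol f"
      using lower True by blast
    finally show ?thesis
      using K by (simp add: ennreal_mult_le_mult_iff)
  next
    case False
    then show ?thesis using vol_neg by (force simp: not_le)
  qed
  have "f = ?g" if eq: "sublevel_vol ?g = sublevel_vol f"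
  proof -
    have "eval_form f x \<ge> 0" for x
      using vol_neg[of x] vol_g eq by force
    then have "ennreal (LINT x:B|lborel. 1 - eval_form f x) \<le> ennreal (LINT x:B|lborel. 1 - eval_form ?g x)"
      using lower by (simp add: vol_g_eq flip: eq)
    then have "(LINT x:B|lborel. 1 - eval_form f x) \<le> (LINT x:B|lborel. 1 - eval_form ?g x)"
      using nonneg_g by (simp add: ennreal_le_iff)
    then have "bombieri_inner d f ?g \<ge> 1"
      unfolding sub int[OF g(1)] int[OF assms(3)] inner_g using mult_le_cancel_left_pos[OF CN, of 1] by simp
    then show ?thesis
      using g by (intro bombieri_inner_eq_1[OF assms(4)]) (auto simp: assms)
  qed
  with le sublevel_vol_b_unit[OF assms(2,1)] show ?thesis by auto
qed

end
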